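(* Consider $F=f+g$ and let the (possibly random) iterates $\mathbf{x}^1,\dots,\mathbf{x}^K$ be generated by the Proximal Arbitrary-Block Descent Method described in the context, from a deterministic $\mathbf{x}^0\in\mathrm{dom}(g)$ and an arbitrary sequence $S_0,\dots,S_{K-1}$ of non-empty (possibly random) subsets of $[n]$. Assume that $F$ is strongly PL with parameter $\mu>0$, i.e. $\mu(\mathbf{x})\ge\mu$ for all $\mathbf{x}\in\mathrm{dom}(g)\setminus\mathcal{X}^*$, where $\mu(\cdot)$ is the proximal forcing function. Let $$\mu_k:=\frac{\mu\,\mathbf{E}[\xi(\mathbf{x}^k)\,\theta(S_k,\mathbf{x}^k)]}{\mathbf{E}[\xi(\mathbf{x}^k)]},\qquad k=0,\dots,K-1 .$$ Then for every $\epsilon>0$, $$\sum_{k=0}^{K-1}\mu_k\ge\log\left(\frac{\xi(\mathbf{x}^0)}{\epsilon}\right)\quad\Longrightarrow\quad\mathbf{E}[\xi(\mathbf{x}^K)]\le\epsilon .$$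
   Context: Notation: $[n]=\{1,\dots,n\}$, $\bar{\mathbb{R}}=\mathbb{R}\cup\{+\infty\}$, $\|\cdot\|$ Euclidean norm. For $\emptyset\ne S\subseteq[n]$, $\mathbf{x}_{[S]}\in\mathbb{R}^n$ is $\mathbf{x}$ with entries outside $S$ set to zero, and $\mathbf{M}_{[S]}\in\mathbb{R}^{n\times n}$ is $\mathbf{M}$ with all entries outside the rows and columns in $S$ set to zero. Setup: $f:\mathbb{R}^n\to\mathbb{R}$ is differentiable and $\mathbf{M}$-smooth for a (symmetric) positive definite matrix $\mathbf{M}$: $f(\mathbf{x}+\mathbf{h})\le f(\mathbf{x})+\langle\nabla f(\mathbf{x}),\mathbf{h}\rangle+\frac12\langle\mathbf{M}\mathbf{h},\mathbf{h}\rangle$ for all $\mathbf{x},\mathbf{h}$. $g:\mathbb{R}^n\to\bar{\mathbb{R}}$ is separable: $g(\mathbf{x})=\sum_{i=1}^n g_i(x_i)$ with $g_i:\mathbb{R}\to\bar{\mathbb{R}}$. $F=f+g$ has a global minimizer $\mathbf{x}^*$ with $F(\mathbf{x}^* )>-\infty$; $\mathcal{X}^*=\operatorname{argmin}F$. Standing convention: either $g=0$ (smooth case; $\mathbf{M}$ arbitrary positive definite), or $\mathbf{M}=L\mathbf{I}$ for some $L>0$. In general $L>0$ denotes a constant such that $f$ is $L\mathbf{I}$-smooth (with $\mathbf{M}=L\mathbf{I}$ when $g\neq0$; when $g=0$ the quantities below do not depend on the choice of $L$). Define $U_S(\mathbf{x},\mathbf{u}):=\langle(\nabla f(\mathbf{x}))_{[S]},\mathbf{u}\rangle+\frac12\mathbf{u}^\top\mathbf{M}_{[S]}\mathbf{u}+\sum_{i\in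 S}[g_i(x_i+u_i)-g_i(x_i)]$. Algorithm (Proximal Arbitrary-Block Descent Method): for $k=0,\dots,K-1$, pick a non-empty $S_k\subseteq[n]$ by an arbitrary (deterministic or random, possibly history-dependent) procedure, choose $\mathbf{u}^k\in\operatorname{argmin}_{\mathbf{u}}U_{S_k}(\mathbf{x}^k,\mathbf{u})$, and set $\mathbf{x}^{k+1}=\mathbf{x}^k+\mathbf{u}^k_{[S_k]}$. The minima involved are assumed to be attained (and, in the random case, all iterates are random variables). Functions: optimality gap $\xi(\mathbf{x}):=F(\mathbf{x})-F(\mathbf{x}^* )$; $\lambda(\mathbf{x}):=-L\cdot\min_{\mathbf{y}\in\mathbb{R}^n}\{\langle\nabla f(\mathbf{x}),\mathbf{y}\rangle+\frac L2\|\mathbf{y}\|^2+g(\mathbf{x}+\mathbf{y})-g(\mathbf{x})\}$ (equal to $\frac12\|\nabla f(\mathbf{x})\|^2$ if $g=0$); proximal forcing function $\mu(\mathbf{x}):=\lambda(\mathbf{x})/\xi(\mathbf{x})$ for $\mathbf{x}\in\mathrm{dom}(g)\setminus\mathcal{X}^*$; proportion function $\theta(S,\mathbf{x}):=\frac{-\min_{\mathbf{u}\in\mathbb{R}^n}U_S(\mathbf{x},\mathbf{u})}{\lambda(\mathbf{x})}$ if $\lambda(\mathbf{x})\neq0$, and $\theta(S,\mathbf{x}):=0$ if $\lambda(\mathbf{x})=0$. Degenerate conventions: $\mu_k:=0$ if $\mathbf{E}[\xi(\mathbf{x}^k)]=0$; $\log 0:=-\infty$. *)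

theory Defs
  imports "HOL-Probability.Probability"
begin

definition restrict_vec :: "'n set \<Rightarrow> real ^ 'n \<Rightarrow> real ^ ('n::finite)" where
  "restrict_vec S x = (\<chi> i. if i \<in> S then x $ i else 0)"

definition restrict_mat :: "'n set \<Rightarrow> real ^ 'n ^ 'n \<Rightarrow> real ^ 'n ^ ('n::finite)" where
  "restrict_mat S M = (\<chi> i j. if i \<in> S \<and> j \<in> S then M $ i $ j else 0)"

definition sym_pos_def :: "real ^ 'n ^ ('n::finite) \<Rightarrow> bool" where
  "sym_pos_def M \<longleftrightarrow> transpose M = M \<and> (\<forall>x. x \<noteq> 0 \<longrightarrow> 0 < (M *v x) \<bullet> x)"

(* f' is the gradient of f. *)
definition matrix_smooth ::
  "(real ^ 'n \<Rightarrow> real) \<Rightarrow> (real ^ 'n \<Rightarrow> real ^ 'n) \<Rightarrow> real ^ 'n ^ ('n::finite) \<Rightarrow> bool" where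
  "matrix_smooth f f' M \<longleftrightarrow>
     (\<forall>x h. f (x + h) \<le> f x + f' x \<bullet> h + 1 / 2 * ((M *v h) \<bullet> h))"

(* Extended-valued functions take values in ereal; -\<infinity> is excluded by a hypothesis where they
   are used, so that they range over the reals together with +\<infinity>. *)
definition separable_sum :: "('n \<Rightarrow> real \<Rightarrow> ereal) \<Rightarrow> real ^ ('n::finite) \<Rightarrow> ereal" where
  "separable_sum g x = (\<Sum>i\<in>UNIV. g i (x $ i))"

definition eff_dom :: "('a \<Rightarrow> ereal) \<Rightarrow> 'a set" where
  "eff_dom h = {x. h x < \<infinity>}"

abbreviation global_min :: "('a \<Rightarrow> ereal) \<Rightarrow> 'a \<Rightarrow> bool" where
  "global_min h x \<equiv> is_arg_min h (\<lambda>_. True) x"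

definition objective ::
  "(real ^ 'n \<Rightarrow> real) \<Rightarrow> ('n \<Rightarrow> real \<Rightarrow> ereal) \<Rightarrow> real ^ ('n::finite) \<Rightarrow> ereal" where
  "objective f g x = ereal (f x) + separable_sum g x"

(* The differences of values of g below are only used for x in the effective domain of g,
   where the subtracted terms are finite. *)
definition block_model ::
  "(real ^ 'n \<Rightarrow> real ^ 'n) \<Rightarrow> real ^ 'n ^ 'n \<Rightarrow> ('n \<Rightarrow> real \<Rightarrow> ereal) \<Rightarrow>
   'n set \<Rightarrow> real ^ 'n \<Rightarrow> real ^ ('n::finite) \<Rightarrow> ereal" where
  "block_model f' M g S x u =
     ereal (restrict_vec S (f' x) \<bullet> u + 1 / 2 * (u \<bullet> (restrict_mat S M *v u)))
     + (\<Sum>i\<in>S. g i (x $ i + u $ i) - g i (x $ i))"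

definition prox_model ::
  "(real ^ 'n \<Rightarrow> real ^ 'n) \<Rightarrow> real \<Rightarrow> ('n \<Rightarrow> real \<Rightarrow> ereal) \<Rightarrow>
   real ^ 'n \<Rightarrow> real ^ ('n::finite) \<Rightarrow> ereal" where
  "prox_model f' L g x y =
     ereal (f' x \<bullet> y + L / 2 * (norm y)\<^sup>2) + (separable_sum g (x + y) - separable_sum g x)"

(* Deterministic trajectory of the method: one realisation of blocks S, steps u, iterates x. *)
definition block_descent_path ::
  "(real ^ 'n \<Rightarrow> real ^ 'n) \<Rightarrow> real ^ 'n ^ 'n \<Rightarrow> ('n \<Rightarrow> real \<Rightarrow> ereal) \<Rightarrow> nat \<Rightarrow>
   (nat \<Rightarrow> 'n set) \<Rightarrow> (nat \<Rightarrow> real ^ 'n) \<Rightarrow> (nat \<Rightarrow> real ^ ('n::finite)) \<Rightarrow> bool" where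
  "block_descent_path f' M g K S u x \<longleftrightarrow>
     (\<forall>k<K. S k \<noteq> {} \<and> global_min (block_model f' M g (S k) (x k)) (u k)
            \<and> x (Suc k) = x k + restrict_vec (S k) (u k))"

definition opt_gap ::
  "(real ^ 'n \<Rightarrow> real) \<Rightarrow> ('n \<Rightarrow> real \<Rightarrow> ereal) \<Rightarrow> real ^ 'n \<Rightarrow> real ^ ('n::finite) \<Rightarrow> real" where
  "opt_gap f g xstar x = real_of_ereal (objective f g x - objective f g xstar)"

(* The infima in the next two definitions are minima wherever they are used: attainment is
   assumed there, and then the values are finite for x in the effective domain of g. *)
definition prox_decrease ::
  "(real ^ 'n \<Rightarrow> real ^ 'n) \<Rightarrow> real \<Rightarrow> ('n \<Rightarrow> real \<Rightarrow> ereal) \<Rightarrow> real ^ ('n::finite) \<Rightarrow> real" where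
  "prox_decrease f' L g x = - L * real_of_ereal (INF y. prox_model f' L g x y)"

definition proportion ::
  "(real ^ 'n \<Rightarrow> real ^ 'n) \<Rightarrow> real ^ 'n ^ 'n \<Rightarrow> real \<Rightarrow> ('n \<Rightarrow> real \<Rightarrow> ereal) \<Rightarrow>
   'n set \<Rightarrow> real ^ ('n::finite) \<Rightarrow> real" where
  "proportion f' M L g S x =
     (if prox_decrease f' L g x = 0 then 0
      else - real_of_ereal (INF u. block_model f' M g S x u) / prox_decrease f' L g x)"

definition prox_forcing ::
  "(real ^ 'n \<Rightarrow> real) \<Rightarrow> (real ^ 'n \<Rightarrow> real ^ 'n) \<Rightarrow> real \<Rightarrow> ('n \<Rightarrow> real \<Rightarrow> ereal) \<Rightarrow>
   real ^ 'n \<Rightarrow> real ^ ('n::finite) \<Rightarrow> real" where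
  "prox_forcing f f' L g xstar x = prox_decrease f' L g x / opt_gap f g xstar x"

definition strongly_PL ::
  "(real ^ 'n \<Rightarrow> real) \<Rightarrow> (real ^ 'n \<Rightarrow> real ^ 'n) \<Rightarrow> real \<Rightarrow> ('n \<Rightarrow> real \<Rightarrow> ereal) \<Rightarrow>
   real ^ ('n::finite) \<Rightarrow> real \<Rightarrow> bool" where
  "strongly_PL f f' L g xstar \<mu> \<longleftrightarrow>
     (\<forall>x \<in> eff_dom (separable_sum g) - {x. global_min (objective f g) x}.
        \<mu> \<le> prox_forcing f f' L g xstar x)"

(* \<mu> * E[\<xi> \<theta>] / E[\<xi>], with value 0 when E[\<xi>] = 0. *)
definition weighted_rate ::
  "'a measure \<Rightarrow> real \<Rightarrow> ('a \<Rightarrow> real) \<Rightarrow> ('a \<Rightarrow> real) \<Rightarrow> real" where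
  "weighted_rate P \<mu> \<xi> \<theta> =
     (if integral\<^sup>L P \<xi> = 0 then 0
      else \<mu> * integral\<^sup>L P (\<lambda>\<omega>. \<xi> \<omega> * \<theta> \<omega>) / integral\<^sup>L P \<xi>)"

(* The library has ln 0 = 0; here log 0 = -\<infinity>. Only used for nonnegative arguments. *)
definition ext_ln :: "real \<Rightarrow> ereal" where
  "ext_ln t = (if t = 0 then -\<infinity> else ereal (ln t))"

end

theory Submission
  imports Defs
begin

text \<open>
  Along every realisation, smoothness of \<open>f\<close> turns the minimal value \<open>U\<close> of the block model into a
  guaranteed decrease of \<open>F\<close>, and strong PL gives \<open>\<mu> \<xi> \<theta> \<le> - U\<close>, so
  \<open>\<xi> (x (k + 1)) \<le> \<xi> (x k) - \<mu> \<xi> (x k) \<theta> (S k, x k)\<close>. Taking expectations yields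
  \<open>E \<xi> (x (k + 1)) \<le> (1 - \<mu>\<^sub>k) E \<xi> (x k) \<le> exp (- \<mu>\<^sub>k) E \<xi> (x k)\<close>, and these bounds multiply.

  The \<open>g\<^sub>i\<close> need not be measurable, so some \<open>\<xi> (x k)\<close> may fail to be integrable. The Bochner integral
  is then \<open>0\<close>, hence so is \<open>\<mu>\<^sub>k\<close>, and such a step can be skipped because \<open>\<xi>\<close> decreases along every
  realisation.
\<close>

section \<open>Block restrictions, finiteness and the optimality gap\<close>

text \<open>The block model uses \<open>restrict_mat S M\<close> and the full vector
  \<open>u\<close>, smoothness uses \<open>M\<close> and a displacement. This identity and the next
  rewrite the first form into the second, with displacement \<open>restrict_vec S u\<close>.\<close>

lemma restrict_mat_quadratic_form:
  fixes u :: "real ^ ('n::finite)"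
  shows "u \<bullet> (restrict_mat S M *v u) = (M *v restrict_vec S u) \<bullet> restrict_vec S u"
  unfolding inner_vec_def restrict_mat_def restrict_vec_def matrix_vector_mult_def
  by (auto simp: sum_distrib_left sum_distrib_right intro!: sum.cong)

lemma inner_restrict_vec_left: "restrict_vec S a \<bullet> u = a \<bullet> restrict_vec S u"
  unfolding inner_vec_def restrict_vec_def by (intro sum.cong) auto

text \<open>A finite \<open>ereal\<close> sum is \<infinity> exactly when some summand is, and
  excluding -\<infinity> makes every other value finite.\<close>

lemma separable_sum_finite_iff:
  fixes x :: "real ^ ('n::finite)"
  assumes "\<And>i t. g i t \<noteq> -\<infinity>"
  shows "x \<in> eff_dom (separable_sum g) \<longleftrightarrow> (\<forall>i. \<bar>g i (x $ i)\<bar> \<noteq> \<infinity>)"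
proof -
  have "\<bar>g i t\<bar> \<noteq> \<infinity> \<longleftrightarrow> g i t \<noteq> \<infinity>" for i t
    using assms[of i t] by (cases "g i t") auto
  then show ?thesis
    by (auto simp: eff_dom_def separable_sum_def sum_Pinfty)
qed

lemma separable_sum_eq_real:
  fixes x :: "real ^ ('n::finite)"
  assumes "\<And>i. \<bar>g i (x $ i)\<bar> \<noteq> \<infinity>"
  shows "separable_sum g x = ereal (\<Sum>i\<in>UNIV. real_of_ereal (g i (x $ i)))"
  unfolding separable_sum_def sum_ereal[symmetric]
  using assms by (intro sum.cong) (auto simp: ereal_real)

lemma objective_finite:
  assumes "\<And>i t. g i t \<noteq> -\<infinity>" and "x \<in> eff_dom (separable_sum g)"
  shows "\<bar>objective f g x\<bar> \<noteq> \<infinity>"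
  using assms by (simp add: objective_def separable_sum_finite_iff separable_sum_eq_real)

lemma global_min_objective_finite:
  assumes "\<And>i t. g i t \<noteq> -\<infinity>" and "x \<in> eff_dom (separable_sum g)"
    and "global_min (objective f g) xstar" and "objective f g xstar > -\<infinity>"
  shows "\<bar>objective f g xstar\<bar> \<noteq> \<infinity>"
proof -
  have "objective f g xstar \<le> objective f g x"
    using assms(3) by (auto simp: is_arg_min_def not_less)
  then show ?thesis
    using objective_finite[of g x f] assms by auto
qed

lemma opt_gap_nonneg:
  assumes "\<And>i t. g i t \<noteq> -\<infinity>" and "x \<in> eff_dom (separable_sum g)"
    and "global_min (objective f g) xstar" and "objective f g xstar > -\<infinity>"
  shows "opt_gap f g xstar x \<ge> 0"
proof -
  have "objective f g xstar \<le> objective f g x"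
    using assms(3) by (auto simp: is_arg_min_def not_less)
  then show ?thesis
    using global_min_objective_finite[of g x f xstar] assms
    by (auto simp: opt_gap_def intro!: real_of_ereal_pos ereal_diff_positive)
qed

text \<open>\<open>real_of_ereal\<close> sends \<infinity> to 0, so a zero gap means equality only
  because both values are finite here. This links case splits on the gap to strong PL, which speaks
  of points that are not minimizers.\<close>

lemma opt_gap_eq_0_iff:
  assumes "\<And>i t. g i t \<noteq> -\<infinity>" and "x \<in> eff_dom (separable_sum g)"
    and "global_min (objective f g) xstar" and "objective f g xstar > -\<infinity>"
  shows "opt_gap f g xstar x = 0 \<longleftrightarrow> global_min (objective f g) x"
proof -
  obtain a b where ab: "objective f g x = ereal a" "objective f g xstar = ereal b"
    using global_min_objective_finite[of g x f xstar] objective_finite[of g x f] assms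
    by (metis ereal_real')
  have "global_min (objective f g) x \<longleftrightarrow> objective f g x = objective f g xstar"
    using assms(3) by (metis (no_types, lifting) is_arg_min_def linorder_neqE)
  then show ?thesis
    by (auto simp: opt_gap_def ab)
qed

section \<open>Decrease of the objective in one step\<close>

text \<open>Coordinates outside \<open>S\<close> do not move, so the sum over \<open>S\<close> is
  the whole change of the separable part; the remaining terms are the smoothness bound for the
  displacement \<open>restrict_vec S u\<close>.\<close>

lemma block_model_step:
  fixes x u :: "real ^ ('n::finite)"
  assumes smooth: "matrix_smooth f f' M"
    and g_range: "\<And>i t. g i t \<noteq> -\<infinity>"
    and x: "x \<in> eff_dom (separable_sum g)"
    and fin: "block_model f' M g S x u < \<infinity>"
  defines "x' \<equiv> x + restrict_vec S u"
  shows "x' \<in> eff_dom (separable_sum g)"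
    and "\<bar>block_model f' M g S x u\<bar> \<noteq> \<infinity>"
    and "objective f g x' \<le> objective f g x + block_model f' M g S x u"
proof -
  have gx: "\<bar>g i (x $ i)\<bar> \<noteq> \<infinity>" for i
    using x g_range by (simp add: separable_sum_finite_iff)
  have "(\<Sum>i\<in>S. g i (x $ i + u $ i) - g i (x $ i)) \<noteq> \<infinity>"
    using fin by (auto simp: block_model_def)
  \<comment> \<open>The subtracted values are finite, so one infinite new value would make the whole
    sum infinite.\<close>
  then have "g i (x $ i + u $ i) \<noteq> \<infinity>" if "i \<in> S" for i
    using that gx[of i] by (cases "g i (x $ i)") (force simp: sum_Pinfty)+
  then have gx': "\<bar>g i (x' $ i)\<bar> \<noteq> \<infinity>" for i
    using gx[of i] g_range by (auto simp: x'_def restrict_vec_def)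
  show "x' \<in> eff_dom (separable_sum g)"
    using gx' g_range by (simp add: separable_sum_finite_iff)
  define r where "r i = real_of_ereal (g i (x $ i))" for i
  define r' where "r' i = real_of_ereal (g i (x' $ i))" for i
  define q where "q = f' x \<bullet> restrict_vec S u
    + 1 / 2 * ((M *v restrict_vec S u) \<bullet> restrict_vec S u)"
  have r: "g i (x $ i) = ereal (r i)" "g i (x' $ i) = ereal (r' i)" for i
    using gx[of i] gx'[of i] by (simp_all add: r_def r'_def ereal_real)
  have "g i (x $ i + u $ i) - g i (x $ i) = ereal (r' i - r i)" if "i \<in> S" for i
    using that r[of i] by (simp add: x'_def restrict_vec_def)
  then have "(\<Sum>i\<in>S. g i (x $ i + u $ i) - g i (x $ i)) = ereal (\<Sum>i\<in>S. r' i - r i)"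
    by simp
  also have "(\<Sum>i\<in>S. r' i - r i) = (\<Sum>i\<in>UNIV. r' i - r i)"
    by (rule sum.mono_neutral_left) (auto simp: r_def r'_def x'_def restrict_vec_def)
  finally have model: "block_model f' M g S x u = ereal (q + (\<Sum>i\<in>UNIV. r' i - r i))"
    by (simp add: block_model_def q_def restrict_mat_quadratic_form inner_restrict_vec_left)
  show "\<bar>block_model f' M g S x u\<bar> \<noteq> \<infinity>"
    by (simp add: model)
  have "f x' \<le> f x + q"
    using smooth by (simp add: matrix_smooth_def x'_def q_def add.assoc)
  then show "objective f g x' \<le> objective f g x + block_model f' M g S x u"
    using separable_sum_eq_real[of g x] separable_sum_eq_real[of g x'] gx gx'
    by (simp add: objective_def model sum_subtractf flip: r_def r'_def)
qed

lemma block_model_0: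
  assumes "\<And>i t. g i t \<noteq> -\<infinity>" and "x \<in> eff_dom (separable_sum g)"
  shows "block_model f' M g S x 0 = 0"
  using assms by (simp add: block_model_def separable_sum_finite_iff)

text \<open>Plain monotonicity is recorded beside the sharper bound because it carries the estimate
  across steps whose rate is 0.\<close>

lemma block_descent_step:
  fixes x u :: "real ^ ('n::finite)"
  assumes smooth: "matrix_smooth f f' M"
    and g_range: "\<And>i t. g i t \<noteq> -\<infinity>"
    and minimizer: "global_min (objective f g) xstar"
    and minimum_finite: "objective f g xstar > -\<infinity>"
    and mu_pos: "\<mu> > 0"
    and PL: "strongly_PL f f' L g xstar \<mu>"
    and x: "x \<in> eff_dom (separable_sum g)"
    and u: "global_min (block_model f' M g S x) u"
  defines "x' \<equiv> x + restrict_vec S u"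
  shows "x' \<in> eff_dom (separable_sum g)"
    and "opt_gap f g xstar x' \<le> opt_gap f g xstar x"
    and "opt_gap f g xstar x'
           \<le> opt_gap f g xstar x - \<mu> * (opt_gap f g xstar x * proportion f' M L g S x)"
proof -
  let ?U = "block_model f' M g S x" and ?\<xi> = "opt_gap f g xstar"
  have U_min: "?U u \<le> ?U v" for v
    using u by (auto simp: is_arg_min_def not_less)
  \<comment> \<open>The zero step is a competitor with model value 0.\<close>
  have U_le_0: "?U u \<le> 0"
    using U_min[of 0] block_model_0[of g x f' M S] g_range x by simp
  then have "?U u < \<infinity>"
    by (rule order.strict_trans1) simp
  note step = block_model_step[OF smooth g_range x this, folded x'_def]
  show x': "x' \<in> eff_dom (separable_sum g)"
    by (rule step)
  define U where "U = real_of_ereal (?U u)"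
  have U: "?U u = ereal U"
    using step(2) by (simp add: U_def ereal_real)
  \<comment> \<open>This ties \<open>proportion\<close>, defined through the infimum, to the step
    actually taken.\<close>
  have "(INF v. ?U v) = ?U u"
    using U_min by (intro antisym INF_lower INF_greatest) auto
  then have INF_U: "real_of_ereal (INF v. ?U v) = U"
    by (simp add: U)
  have "U \<le> 0"
    using U_le_0 by (simp add: U)
  obtain a a' b where
    "objective f g x = ereal a" "objective f g x' = ereal a'" "objective f g xstar = ereal b"
    using global_min_objective_finite[OF g_range x minimizer minimum_finite]
      objective_finite[OF g_range x, of f] objective_finite[OF g_range x', of f]
    by (metis ereal_real')
  then have decrease: "?\<xi> x' \<le> ?\<xi> x + U"
    using step(3) by (simp add: U opt_gap_def)
  show "?\<xi> x' \<le> ?\<xi> x"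
    using decrease \<open>U \<le> 0\<close> by simp
  have "\<mu> * (?\<xi> x * proportion f' M L g S x) \<le> - U"
  \<comment> \<open>Strong PL says nothing at zero gap, but there the factor \<open>?\<xi> x\<close>
    makes the left side vanish.\<close>
  proof (cases "?\<xi> x = 0")
    case True
    then show ?thesis
      using \<open>U \<le> 0\<close> by simp
  next
    case False
    let ?l = "prox_decrease f' L g x"
    have pos: "?\<xi> x > 0"
      using False opt_gap_nonneg[OF g_range x minimizer minimum_finite] by simp
    have "\<mu> \<le> ?l / ?\<xi> x"
      using PL x False opt_gap_eq_0_iff[OF g_range x minimizer minimum_finite]
      by (auto simp: strongly_PL_def prox_forcing_def)
    then have le: "\<mu> * ?\<xi> x \<le> ?l"
      using pos by (simp add: pos_le_divide_eq)
    moreover have "0 < \<mu> * ?\<xi> x"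
      using mu_pos pos by simp
    ultimately have "?l > 0"
      by linarith
    \<comment> \<open>Strong PL bounds the fraction on the right by 1, and \<open>- U\<close> is
      nonnegative.\<close>
    have "\<mu> * (?\<xi> x * proportion f' M L g S x) = (\<mu> * ?\<xi> x / ?l) * (- U)"
      using \<open>?l > 0\<close> by (simp add: proportion_def INF_U)
    also have "\<dots> \<le> 1 * (- U)"
      using le \<open>?l > 0\<close> \<open>U \<le> 0\<close> by (intro mult_right_mono) (simp_all add: pos_divide_le_eq)
    finally show ?thesis
      by simp
  qed
  then show "?\<xi> x' \<le> ?\<xi> x - \<mu> * (?\<xi> x * proportion f' M L g S x)"
    using decrease by linarith
qed

section \<open>Passage to expectations\<close>

text \<open>The method enters only through inequalities at each outcome, so no conditional
  expectations appear and the blocks may depend on the history in any way.\<close>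

lemma integral_le_exp_weighted_rates:
  fixes \<xi> \<theta> :: "nat \<Rightarrow> 'a \<Rightarrow> real"
  assumes prob: "prob_space P"
    and nonneg: "\<And>k \<omega>. k \<le> K \<Longrightarrow> \<omega> \<in> space P \<Longrightarrow> \<xi> k \<omega> \<ge> 0"
    and start: "\<And>\<omega>. \<omega> \<in> space P \<Longrightarrow> \<xi> 0 \<omega> = c"
    and decr: "\<And>k \<omega>. k < K \<Longrightarrow> \<omega> \<in> space P \<Longrightarrow> \<xi> (Suc k) \<omega> \<le> \<xi> k \<omega>"
    and step: "\<And>k \<omega>. k < K \<Longrightarrow> \<omega> \<in> space P \<Longrightarrow>
      \<xi> (Suc k) \<omega> \<le> \<xi> k \<omega> - \<mu> * (\<xi> k \<omega> * \<theta> k \<omega>)"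
  shows "integral\<^sup>L P (\<xi> K) \<le> c * exp (- (\<Sum>k<K. weighted_rate P \<mu> (\<xi> k) (\<theta> k)))"
proof -
  interpret prob_space P by fact
  obtain \<omega>\<^sub>0 where "\<omega>\<^sub>0 \<in> space P"
    using not_empty by blast
  then have "c \<ge> 0"
    using nonneg[of 0 \<omega>\<^sub>0] start[of \<omega>\<^sub>0] by simp
  let ?r = "\<lambda>k. weighted_rate P \<mu> (\<xi> k) (\<theta> k)"
  have mono: "\<xi> j \<omega> \<le> \<xi> k \<omega>" if "k \<le> j" "j \<le> K" "\<omega> \<in> space P" for j k \<omega>
    using that
  proof (induction rule: dec_induct)
    case (step j)
    then show ?case
      using decr[of j \<omega>] by simp
  qed simp
  \<comment> \<open>Here \<open>k\<close> counts exponential factors while \<open>j\<close> stays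
    free: a zero-rate step keeps the same integrable \<open>\<xi> j\<close> and only lowers
    \<open>k\<close>.\<close>
  have bound: "integral\<^sup>L P (\<xi> j) \<le> c * exp (- (\<Sum>i<k. ?r i))"
    if "k \<le> j" "j \<le> K" "integrable P (\<xi> j)" for j k
    using that
  proof (induction k arbitrary: j)
    case 0
    have "\<xi> j \<omega> \<le> c" if "\<omega> \<in> space P" for \<omega>
      using mono[OF 0(1,2) that] start[OF that] by simp
    then show ?case
      using 0 integral_mono[of P "\<xi> j" "\<lambda>_. c"] by (simp add: prob_space)
  next
    case (Suc k)
    show ?case
    proof (cases "?r k = 0")
      case True
      then show ?thesis
        using Suc.IH[of j] Suc.prems by simp
    next
      case False
      let ?E = "integral\<^sup>L P (\<xi> k)" and ?p = "\<lambda>\<omega>. \<xi> k \<omega> * \<theta> k \<omega>"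
      have E: "?E \<noteq> 0" and rate: "?r k = \<mu> * integral\<^sup>L P ?p / ?E"
        using False by (auto simp: weighted_rate_def split: if_splits)
      have p: "integral\<^sup>L P ?p \<noteq> 0"
        using False rate by auto
      \<comment> \<open>A nonzero Bochner integral certifies integrability, since the default value
        is 0.\<close>
      have int: "integrable P (\<xi> k)" "integrable P ?p"
        using E p not_integrable_integral_eq by blast+
      have "integral\<^sup>L P (\<xi> j) \<le> integral\<^sup>L P (\<lambda>\<omega>. \<xi> k \<omega> - \<mu> * ?p \<omega>)"
      proof (rule integral_mono)
        fix \<omega> assume "\<omega> \<in> space P"
        then show "\<xi> j \<omega> \<le> \<xi> k \<omega> - \<mu> * ?p \<omega>"
          using mono[of "Suc k" j \<omega>] step[of k \<omega>] Suc.prems by simp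
      qed (use Suc.prems int in auto)
      also have "\<dots> = ?E - \<mu> * integral\<^sup>L P ?p"
        using int by simp
      also have "\<dots> = ?E * (1 - ?r k)"
        using E by (simp add: rate field_simps)
      \<comment> \<open>The bound 1 - r \<le> exp (- r) holds for every real r, so a rate above 1
        does no harm.\<close>
      also have "\<dots> \<le> ?E * exp (- ?r k)"
      proof (rule mult_left_mono)
        show "1 - ?r k \<le> exp (- ?r k)"
          using exp_ge_add_one_self[of "- ?r k"] by simp
        show "0 \<le> ?E"
          using nonneg[of k] Suc.prems by (intro Bochner_Integration.integral_nonneg) auto
      qed
      \<comment> \<open>The induction hypothesis is taken at \<open>j = k\<close>, where
        integrability has just been obtained.\<close>
      also have "\<dots> \<le> c * exp (- (\<Sum>i<k. ?r i)) * exp (- ?r k)"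
        using Suc.IH[of k] Suc.prems int by simp
      also have "\<dots> = c * exp (- (\<Sum>i<Suc k. ?r i))"
        by (simp add: exp_diff exp_minus field_simps)
      finally show ?thesis .
    qed
  qed
  show ?thesis
  proof (cases "integrable P (\<xi> K)")
    case True
    then show ?thesis
      by (intro bound) auto
  next
    \<comment> \<open>The integral is 0 by default, and the bound is nonnegative because
      \<open>c \<ge> 0\<close>.\<close>
    case False
    then show ?thesis
      using \<open>c \<ge> 0\<close> by (simp add: not_integrable_integral_eq)
  qed
qed

text \<open>Exponentiate the rate condition. For \<open>c = 0\<close> its left side is -\<infinity>,
  so it carries no information, but the conclusion is then trivial.\<close>

lemma mult_exp_le_of_ext_ln_le:
  assumes "c \<ge> 0" and "\<epsilon> > 0" and "ext_ln (c / \<epsilon>) \<le> ereal s"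
  shows "c * exp (- s) \<le> \<epsilon>"
proof (cases "c = 0")
  case False
  then have pos: "c / \<epsilon> > 0"
    using assms by simp
  then have "ln (c / \<epsilon>) \<le> s"
    using assms(3) by (auto simp: ext_ln_def split: if_splits)
  then have "c / \<epsilon> \<le> exp s"
    using pos by (simp add: ln_le_cancel_iff[symmetric] flip: ln_ge_iff)
  then show ?thesis
    using assms(2) by (simp add: exp_minus field_simps)
qed (use assms in simp)

theorem theorem16:
  fixes f :: "real ^ ('n::finite) \<Rightarrow> real"
    and f' :: "real ^ 'n \<Rightarrow> real ^ 'n"
    and M :: "real ^ 'n ^ 'n"
    and L \<mu> \<epsilon> :: real
    and g :: "'n \<Rightarrow> real \<Rightarrow> ereal"
    and xstar x0 :: "real ^ 'n"
    and P :: "'a measure"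
    and K :: nat
    and S :: "nat \<Rightarrow> 'a \<Rightarrow> 'n set"
    and u X :: "nat \<Rightarrow> 'a \<Rightarrow> real ^ 'n"
  assumes gradient: "\<And>x. GDERIV f x :> f' x"
    and M_pos_def: "sym_pos_def M"
    and M_smooth: "matrix_smooth f f' M"
    and L_pos: "L > 0"
    and L_smooth: "matrix_smooth f f' (mat L)"
    and g_range: "\<And>i t. g i t \<noteq> -\<infinity>"
    and smooth_or_scalar: "(\<forall>x. separable_sum g x = 0) \<or> M = mat L"
    and minimizer: "global_min (objective f g) xstar"
    and minimum_finite: "objective f g xstar > -\<infinity>"
    and prox_min_attained:
      "\<And>x. x \<in> eff_dom (separable_sum g) \<Longrightarrow> \<exists>y. global_min (prox_model f' L g x) y"
    and mu_pos: "\<mu> > 0"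
    and PL: "strongly_PL f f' L g xstar \<mu>"
    and prob: "prob_space P"
    and S_random: "\<And>k. k < K \<Longrightarrow> S k \<in> measurable P (count_space UNIV)"
    and X_random: "\<And>k. k \<le> K \<Longrightarrow> X k \<in> borel_measurable P"
    and x0_dom: "x0 \<in> eff_dom (separable_sum g)"
    and X_start: "\<And>\<omega>. \<omega> \<in> space P \<Longrightarrow> X 0 \<omega> = x0"
    and iteration: "\<And>\<omega>. \<omega> \<in> space P \<Longrightarrow>
      block_descent_path f' M g K (\<lambda>k. S k \<omega>) (\<lambda>k. u k \<omega>) (\<lambda>k. X k \<omega>)"
    and eps_pos: "\<epsilon> > 0"
    and rate: "ereal (\<Sum>k<K. weighted_rate P \<mu> (\<lambda>\<omega>. opt_gap f g xstar (X k \<omega>))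
                                  (\<lambda>\<omega>. proportion f' M L g (S k \<omega>) (X k \<omega>)))
               \<ge> ext_ln (opt_gap f g xstar x0 / \<epsilon>)"
  shows "integral\<^sup>L P (\<lambda>\<omega>. opt_gap f g xstar (X K \<omega>)) \<le> \<epsilon>"
proof -
  let ?\<xi> = "\<lambda>k \<omega>. opt_gap f g xstar (X k \<omega>)"
  let ?\<theta> = "\<lambda>k \<omega>. proportion f' M L g (S k \<omega>) (X k \<omega>)"
  have path: "global_min (block_model f' M g (S k \<omega>) (X k \<omega>)) (u k \<omega>)"
    "X (Suc k) \<omega> = X k \<omega> + restrict_vec (S k \<omega>) (u k \<omega>)"
    if "k < K" "\<omega> \<in> space P" for k \<omega>
    using iteration[OF that(2)] that(1) by (auto simp: block_descent_path_def)
  note step = block_descent_step[OF M_smooth g_range minimizer minimum_finite mu_pos PL]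
  \<comment> \<open>The one-step bounds are stated only inside the domain, so membership is first
    propagated along each realisation.\<close>
  have dom: "X k \<omega> \<in> eff_dom (separable_sum g)" if "k \<le> K" "\<omega> \<in> space P" for k \<omega>
    using that
  proof (induction k)
    case 0
    then show ?case
      using X_start x0_dom by simp
  next
    case (Suc k)
    then show ?case
      using step(1)[OF _ path(1)] path(2) by simp
  qed
  have "integral\<^sup>L P (?\<xi> K)
      \<le> opt_gap f g xstar x0 * exp (- (\<Sum>k<K. weighted_rate P \<mu> (?\<xi> k) (?\<theta> k)))"
  proof (rule integral_le_exp_weighted_rates[OF prob])
    show "?\<xi> k \<omega> \<ge> 0" if "k \<le> K" "\<omega> \<in> space P" for k \<omega>
      using opt_gap_nonneg[OF g_range dom[OF that] minimizer minimum_finite] .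
    show "?\<xi> 0 \<omega> = opt_gap f g xstar x0" if "\<omega> \<in> space P" for \<omega>
      using X_start[OF that] by simp
    show "?\<xi> (Suc k) \<omega> \<le> ?\<xi> k \<omega>"
      and "?\<xi> (Suc k) \<omega> \<le> ?\<xi> k \<omega> - \<mu> * (?\<xi> k \<omega> * ?\<theta> k \<omega>)"
      if "k < K" "\<omega> \<in> space P" for k \<omega>
      using step(2,3)[OF dom path(1)] path(2) that by simp_all
  qed
  also have "\<dots> \<le> \<epsilon>"
    using opt_gap_nonneg[OF g_range x0_dom minimizer minimum_finite] eps_pos rate
    by (rule mult_exp_le_of_ext_ln_le)
  finally show ?thesis .
qed

end
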